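(* Let $(f_k)_{k\ge 0}$ be a sequence of complex numbers with $\ln k=o(\ln|f_k|)$ as $k\to+\infty$. Let $(\lambda_k(\omega))_{k\ge 0}$ be a sequence of positive random variables on a probability space $(\Omega,\mathcal A,P)$, with distribution functions $F_k(x):=P\{\omega:\lambda_k(\omega)<x\}$, $x\in\mathbb R$, $k\ge 0$. Let $\sigma(f,\omega)$ be the abscissa of absolute convergence of the Dirichlet series $f(z,\omega)=\sum_{k=0}^{+\infty}f_k e^{z\lambda_k(\omega)}$. Then: (i) If there exist $\rho\in(0,+\infty)$ and a sequence $(\varepsilon_k)$ of positive numbers with $\varepsilon_k\to 0$ as $k\to+\infty$ such that $$\sum_{k=0}^{+\infty}\Big(1-F_k\Big(\frac{\ln|f_k|}{-\rho+\varepsilon_k}\Big)\Big)<+\infty,$$ then $\sigma(f,\omega)\ge\rho$ almost surely. (ii) If there exist $\rho\in(-\infty,0]$ and a sequence $(\varepsilon_k)$ of positive numbers with $\varepsilon_k\to 0$ as $k\to+\infty$ such that $$\sum_{k=0}^{+\infty}F_k\Big(\frac{\ln|f_k|}{-\rho+\varepsilon_k}\Big)<+\infty,$$ then $\sigma(f,\omega)\ge\rho$ almost surely.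
   Context: For fixed $\omega$, the abscissa of absolute convergence is $\sigma(f,\omega)=\sigma_a(f,\omega):=\sup\{\operatorname{Re} z: z\in\mathbb C,\ \sum_k |f_k e^{z\lambda_k(\omega)}|<+\infty\}\in[-\infty,+\infty]$ (with $\sup\emptyset=-\infty$). Conventions: $\ln 0=-\infty$, $F_k(-\infty)=0$, $F_k(+\infty)=1$; in (i) the (at most finitely many) terms with $\varepsilon_k=\rho$ are disregarded. The condition $\ln k=o(\ln|f_k|)$ means $\ln k/\ln|f_k|\to 0$ as $k\to+\infty$. *)

theory Defs
  imports "HOL-Probability.Probability"
begin

text \<open>
  Logarithm of a nonnegative real with the convention that the logarithm of 0 is minus infinity
  (the library's \<open>ln 0 = 0\<close> on the reals would not do). Quotients of such logarithms are taken in
  \<^typ>\<open>ereal\<close>, where \<open>-\<infinity> / c\<close> is \<open>-\<infinity>\<close> for real \<open>c > 0\<close> and \<open>\<infinity>\<close> for real \<open>c < 0\<close>, and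
  \<open>c / -\<infinity> = 0\<close> for real \<open>c\<close>.
\<close>
definition ext_ln :: "real \<Rightarrow> ereal" where
  "ext_ln x = (if x = 0 then -\<infinity> else ereal (ln x))"

text \<open>
  Left-continuous distribution function, with strict inequality, in contrast to \<^const>\<open>cdf\<close>.
  On a probability space it takes the values 0 at \<open>-\<infinity>\<close> and 1 at \<open>\<infinity>\<close>.
\<close>
definition dist_fun :: "'a measure \<Rightarrow> ('a \<Rightarrow> real) \<Rightarrow> ereal \<Rightarrow> real" where
  "dist_fun M X x = measure M {\<omega> \<in> space M. ereal (X \<omega>) < x}"

lemma dist_fun_ereal: "dist_fun M X (ereal x) = measure M {\<omega> \<in> space M. X \<omega> < x}"
  by (simp add: dist_fun_def)

lemma dist_fun_minf: "dist_fun M X (-\<infinity>) = 0"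
  by (simp add: dist_fun_def)

lemma (in prob_space) dist_fun_inf: "dist_fun M X \<infinity> = 1"
  by (simp add: dist_fun_def prob_space)

text \<open>The supremum is taken in \<^typ>\<open>ereal\<close>, so that it is \<open>-\<infinity>\<close> over the empty set.\<close>
definition abscissa_abs_conv :: "(nat \<Rightarrow> complex) \<Rightarrow> (nat \<Rightarrow> real) \<Rightarrow> ereal" where
  "abscissa_abs_conv f l =
     (SUP z \<in> {z :: complex. summable (\<lambda>k. cmod (f k * exp (z * of_real (l k))))}. ereal (Re z))"

end

theory Submission
  imports Defs
begin

text \<open>
  The smallness of \<open>ln k / ln |f\<^sub>k|\<close> turns absolute convergence into a termwise question: if for some
  \<open>c > 0\<close> eventually \<open>ln |f\<^sub>k| + x \<lambda>\<^sub>k \<le> - c \<bar>ln |f\<^sub>k|\<bar>\<close> at the indices with \<open>f\<^sub>k \<noteq> 0\<close>, then the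
  right-hand side is eventually at most \<open>- 2 ln k\<close> there, and the series at \<open>x\<close> is dominated by the
  sum of \<open>1 / k\<^sup>2\<close> (lemma \<open>summable_dirichlet_series\<close>).

  The summability hypotheses say, by the first Borel-Cantelli lemma, that almost surely \<open>\<lambda>\<^sub>k\<close>
  eventually lies on the side of the threshold \<open>ln |f\<^sub>k| / (- \<rho> + \<epsilon>\<^sub>k)\<close> on which
  \<open>ln |f\<^sub>k| + \<rho> \<lambda>\<^sub>k \<le> \<epsilon>\<^sub>k \<lambda>\<^sub>k\<close>. Passing from \<open>\<rho>\<close> to a fixed \<open>x < \<rho>\<close>,
  taken positive if \<open>\<rho> > 0\<close>, gains a fixed multiple of \<open>\<lambda>\<^sub>k\<close>, which
  absorbs \<open>\<epsilon>\<^sub>k \<lambda>\<^sub>k\<close> and leaves the bound above with \<open>c = (\<rho> - x) / \<bar>\<rho> + x\<bar>\<close> (lemmas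
  \<open>exponent_bound_pos\<close> and \<open>exponent_bound_nonpos\<close>). The Borel-Cantelli event does not depend on \<open>x\<close>,
  so on one set of probability 1 the series converges absolutely for all these \<open>x\<close>, and the
  abscissa is at least \<open>\<rho>\<close>.
\<close>

lemma le_abscissa_abs_convI:
  fixes \<rho> :: real
  assumes "b < ereal \<rho>"
    and "\<And>x. b < ereal x \<Longrightarrow> x < \<rho> \<Longrightarrow>
           summable (\<lambda>k. cmod (f k * exp (complex_of_real x * of_real (l k))))"
  shows "ereal \<rho> \<le> abscissa_abs_conv f l"
proof (rule dense_le_bounded[OF assms(1)])
  fix w assume w: "b < w" "w < ereal \<rho>"
  then obtain x where x: "w = ereal x" by (cases w) auto
  have "summable (\<lambda>k. cmod (f k * exp (complex_of_real x * of_real (l k))))"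
    using assms(2) w x by simp
  then have "ereal (Re (complex_of_real x)) \<le> abscissa_abs_conv f l"
    unfolding abscissa_abs_conv_def by (intro SUP_upper) simp
  then show "w \<le> abscissa_abs_conv f l" using x by simp
qed

text \<open>
  The value \<open>|f\<^sub>k| = 1\<close> can occur only finitely often, because \<open>ln k / 0 = \<infinity>\<close> for \<open>k \<ge> 2\<close>.
  A vanishing coefficient makes the quotient \<open>ln k / -\<infinity> = 0\<close>, so the limit places no restriction
  on such indices; they contribute nothing to the Dirichlet series.
\<close>
lemma eventually_ln_le_mult_abs_ln_cmod:
  assumes "(\<lambda>k. ext_ln (real k) / ext_ln (cmod (f k))) \<longlonglongrightarrow> 0" and "0 < (\<delta>::real)"
  shows "\<forall>\<^sub>F k in sequentially. f k \<noteq> 0 \<longrightarrow> ln (real k) \<le> \<delta> * \<bar>ln (cmod (f k))\<bar>"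
proof -
  have "\<forall>\<^sub>F k in sequentially. ext_ln (real k) / ext_ln (cmod (f k)) < ereal \<delta>"
    using assms by (intro order_tendstoD(2)[OF assms(1)]) simp
  moreover have "\<forall>\<^sub>F k in sequentially. ereal (- \<delta>) < ext_ln (real k) / ext_ln (cmod (f k))"
    using assms by (intro order_tendstoD(1)[OF assms(1)]) simp
  ultimately show ?thesis
    using eventually_ge_at_top[of 2]
  proof eventually_elim
    case (elim k)
    show ?case
    proof
      assume f: "f k \<noteq> 0"
      have pos: "0 < ln (real k)" using elim(3) by simp
      have nz: "ln (cmod (f k)) \<noteq> 0"
      proof
        assume "ln (cmod (f k)) = 0"
        then have "ext_ln (real k) / ext_ln (cmod (f k)) = \<infinity>"
          using f elim(3) pos by (simp add: ext_ln_def divide_ereal_def)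
        then show False using elim(1) by simp
      qed
      have "ext_ln (real k) / ext_ln (cmod (f k)) = ereal (ln (real k) / ln (cmod (f k)))"
        using f elim(3) nz by (simp add: ext_ln_def)
      then have "\<bar>ln (real k) / ln (cmod (f k))\<bar> \<le> \<delta>"
        using elim(1,2) by (simp add: abs_le_iff)
      then show "ln (real k) \<le> \<delta> * \<bar>ln (cmod (f k))\<bar>"
        using nz pos by (simp add: abs_divide pos_divide_le_eq)
    qed
  qed
qed

lemma summable_dirichlet_series:
  assumes lim: "(\<lambda>k. ext_ln (real k) / ext_ln (cmod (f k))) \<longlonglongrightarrow> 0"
    and c: "0 < (c::real)"
    and ev: "\<forall>\<^sub>F k in sequentially.
           f k \<noteq> 0 \<longrightarrow> ln (cmod (f k)) + x * l k \<le> - c * \<bar>ln (cmod (f k))\<bar>"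
  shows "summable (\<lambda>k. cmod (f k * exp (complex_of_real x * of_real (l k))))"
proof (rule summable_comparison_test_ev)
  show "summable (\<lambda>k. inverse (real k ^ 2))"
    by (rule inverse_power_summable) simp
  have "\<forall>\<^sub>F k in sequentially. f k \<noteq> 0 \<longrightarrow> ln (real k) \<le> c / 2 * \<bar>ln (cmod (f k))\<bar>"
    using c by (intro eventually_ln_le_mult_abs_ln_cmod[OF lim]) simp
  with ev show "\<forall>\<^sub>F k in sequentially.
      norm (cmod (f k * exp (complex_of_real x * of_real (l k)))) \<le> inverse (real k ^ 2)"
    using eventually_ge_at_top[of 1]
  proof eventually_elim
    case (elim k)
    show ?case
    proof (cases "f k = 0")
      case False
      have "cmod (f k * exp (complex_of_real x * of_real (l k)))
          = exp (ln (cmod (f k)) + x * l k)"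
        using False by (simp add: norm_mult exp_add)
      also have "\<dots> \<le> exp (- (2 * ln (real k)))"
        using elim False by simp
      also have "\<dots> = inverse (real k ^ 2)"
        using elim(3) by (simp add: exp_minus exp_double)
      finally show ?thesis by simp
    qed simp
  qed
qed

text \<open>
  Positivity of \<open>l\<close> forces \<open>y < 0\<close>, so only coefficients with \<open>|f\<^sub>k| < 1\<close> survive in this case. The bound
  \<open>e \<le> (\<rho> - x) / 2\<close> gives \<open>l < - 2 y / (\<rho> + x)\<close>, whence \<open>y + x l < y (\<rho> - x) / (\<rho> + x)\<close>.
\<close>
lemma exponent_bound_pos:
  fixes \<rho> x y l e :: real
  assumes x: "0 < x" "x < \<rho>" and l: "0 < l" and e: "e \<le> (\<rho> - x) / 2"
    and less: "l < y / (- \<rho> + e)"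
  shows "y + x * l \<le> - ((\<rho> - x) / \<bar>\<rho> + x\<bar>) * \<bar>y\<bar>"
proof -
  have neg: "- \<rho> + e < 0" using x e by argo
  have yl: "y < l * (- \<rho> + e)" using less neg by (simp add: neg_less_divide_eq)
  also have "\<dots> \<le> l * (- (\<rho> + x) / 2)"
    using l e by (intro mult_left_mono) argo+
  finally have y: "l * (\<rho> + x) \<le> - 2 * y" by argo
  have "y < 0" using yl mult_pos_neg[OF l neg] by linarith
  have "x * (l * (\<rho> + x)) \<le> x * (- 2 * y)"
    using x y by (intro mult_left_mono) auto
  then have "(y + x * l) * (\<rho> + x) \<le> (\<rho> - x) * y"
    by (simp add: algebra_simps)
  then show ?thesis
    using x \<open>y < 0\<close> by (simp add: pos_le_divide_eq)
qed

text \<open>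
  Here the exponential helps when \<open>y > 0\<close>: then \<open>l \<ge> - 2 y / (\<rho> + x)\<close> by the bound on \<open>e\<close>. For
  \<open>y \<le> 0\<close> the term \<open>x l\<close> is just dropped, which suffices because \<open>(\<rho> - x) / \<bar>\<rho> + x\<bar> \<le> 1\<close>.
\<close>
lemma exponent_bound_nonpos:
  fixes \<rho> x y l e :: real
  assumes x: "x < \<rho>" "\<rho> \<le> 0" and l: "0 < l" and e: "0 < e" "e \<le> (\<rho> - x) / 2"
    and ge: "y / (- \<rho> + e) \<le> l"
  shows "y + x * l \<le> - ((\<rho> - x) / \<bar>\<rho> + x\<bar>) * \<bar>y\<bar>"
proof (cases "y \<le> 0")
  case True
  have "(\<rho> - x) / \<bar>\<rho> + x\<bar> \<le> 1" using x by simp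
  then have "(\<rho> - x) / \<bar>\<rho> + x\<bar> * \<bar>y\<bar> \<le> 1 * \<bar>y\<bar>" by (rule mult_right_mono) simp
  moreover have "x * l \<le> 0" using x l by (simp add: mult_nonpos_nonneg)
  ultimately show ?thesis using True by linarith
next
  case False
  have pos: "0 < - \<rho> + e" using x e by argo
  have "y \<le> l * (- \<rho> + e)" using ge pos by (simp add: pos_divide_le_eq)
  also have "\<dots> \<le> l * (- (\<rho> + x) / 2)"
    using l e by (intro mult_left_mono) argo+
  finally have y: "2 * y \<le> l * (- (\<rho> + x))" by argo
  have "(- x) * (2 * y) \<le> (- x) * (l * (- (\<rho> + x)))"
    using x y by (intro mult_left_mono) auto
  then have "(\<rho> - x) * y \<le> (y + x * l) * (\<rho> + x)"
    by (simp add: algebra_simps)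
  moreover have neg: "\<rho> + x < 0" using x by argo
  ultimately have "y + x * l \<le> (\<rho> - x) * y / (\<rho> + x)"
    by (simp only: neg_le_divide_eq)
  then show ?thesis using False by (simp add: abs_of_neg[OF neg] del: minus_add_distrib)
qed

lemma (in prob_space) one_minus_dist_fun:
  assumes "X \<in> borel_measurable M"
  shows "1 - dist_fun M X x = prob {\<omega> \<in> space M. \<not> ereal (X \<omega>) < x}"
  unfolding dist_fun_def using assms by (intro prob_neg[symmetric]) measurable

lemma (in prob_space) AE_eventually_not_of_summable_prob:
  assumes "\<And>n. {\<omega> \<in> space M. Q n \<omega>} \<in> events"
    and "summable (\<lambda>n. prob {\<omega> \<in> space M. Q n \<omega>})"
  shows "AE \<omega> in M. \<forall>\<^sub>F n in sequentially. \<not> Q n \<omega>"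
proof -
  have "AE \<omega> in M. \<forall>\<^sub>F n in sequentially. \<omega> \<in> space M - {\<omega> \<in> space M. Q n \<omega>}"
    using assms by (intro borel_cantelli_AE1) (auto simp: emeasure_eq_measure less_top[symmetric])
  then show ?thesis by eventually_elim (auto elim: eventually_mono)
qed

theorem theorem4:
  fixes M :: "'a measure"
    and f :: "nat \<Rightarrow> complex"
    and lam :: "nat \<Rightarrow> 'a \<Rightarrow> real"
  assumes "prob_space M"
    and "\<And>k. lam k \<in> borel_measurable M"
    and "\<And>k \<omega>. \<omega> \<in> space M \<Longrightarrow> 0 < lam k \<omega>"
    and "(\<lambda>k. ext_ln (real k) / ext_ln (cmod (f k))) \<longlonglongrightarrow> 0"
  shows "(\<forall>(\<rho>::real) (\<epsilon>::nat \<Rightarrow> real).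
            0 < \<rho> \<longrightarrow> (\<forall>k. 0 < \<epsilon> k) \<longrightarrow> \<epsilon> \<longlonglongrightarrow> 0 \<longrightarrow>
            summable (\<lambda>k. if \<epsilon> k = \<rho> then 0
              else 1 - dist_fun M (lam k) (ext_ln (cmod (f k)) / ereal (- \<rho> + \<epsilon> k))) \<longrightarrow>
            (AE \<omega> in M. ereal \<rho> \<le> abscissa_abs_conv f (\<lambda>k. lam k \<omega>)))
       \<and> (\<forall>(\<rho>::real) (\<epsilon>::nat \<Rightarrow> real).
            \<rho> \<le> 0 \<longrightarrow> (\<forall>k. 0 < \<epsilon> k) \<longrightarrow> \<epsilon> \<longlonglongrightarrow> 0 \<longrightarrow>
            summable (\<lambda>k. dist_fun M (lam k) (ext_ln (cmod (f k)) / ereal (- \<rho> + \<epsilon> k))) \<longrightarrow>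
            (AE \<omega> in M. ereal \<rho> \<le> abscissa_abs_conv f (\<lambda>k. lam k \<omega>)))"
proof (intro conjI allI impI)
  interpret prob_space M by fact
  note [measurable] = assms(2)
  fix \<rho> :: real and \<epsilon> :: "nat \<Rightarrow> real"
  assume \<rho>: "0 < \<rho>" and lim: "\<epsilon> \<longlonglongrightarrow> 0"
    and sum: "summable (\<lambda>k. if \<epsilon> k = \<rho> then 0
              else 1 - dist_fun M (lam k) (ext_ln (cmod (f k)) / ereal (- \<rho> + \<epsilon> k)))"
  \<comment> \<open>At an index with \<open>\<epsilon>\<^sub>k = \<rho>\<close> the event is empty, to match the disregarded term of the series.\<close>
  define Q where "Q k \<omega> \<longleftrightarrow> \<epsilon> k \<noteq> \<rho> \<and>
      \<not> ereal (lam k \<omega>) < ext_ln (cmod (f k)) / ereal (- \<rho> + \<epsilon> k)" for k \<omega>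
  have "prob {\<omega> \<in> space M. Q k \<omega>} = (if \<epsilon> k = \<rho> then 0
              else 1 - dist_fun M (lam k) (ext_ln (cmod (f k)) / ereal (- \<rho> + \<epsilon> k)))" for k
    using assms(2) by (simp add: Q_def one_minus_dist_fun)
  then have "AE \<omega> in M. \<forall>\<^sub>F k in sequentially. \<not> Q k \<omega>"
    using sum by (intro AE_eventually_not_of_summable_prob) (simp_all add: Q_def)
  then show "AE \<omega> in M. ereal \<rho> \<le> abscissa_abs_conv f (\<lambda>k. lam k \<omega>)"
    using AE_space
  proof eventually_elim
    case (elim \<omega>)
    show ?case
    proof (rule le_abscissa_abs_convI)
      show "0 < ereal \<rho>" using \<rho> by simp
      fix x assume "0 < ereal x" and x: "x < \<rho>"
      then have x0: "0 < x" by simp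
      have "\<forall>\<^sub>F k in sequentially. \<epsilon> k < (\<rho> - x) / 2"
        using x by (intro order_tendstoD(2)[OF lim]) simp
      with elim(1) have "\<forall>\<^sub>F k in sequentially. f k \<noteq> 0 \<longrightarrow> ln (cmod (f k)) + x * lam k \<omega>
          \<le> - ((\<rho> - x) / \<bar>\<rho> + x\<bar>) * \<bar>ln (cmod (f k))\<bar>"
      proof eventually_elim
        case (elim k)
        have "\<epsilon> k < \<rho>" using elim(2) x x0 by argo
        then have "f k \<noteq> 0 \<longrightarrow> lam k \<omega> < ln (cmod (f k)) / (- \<rho> + \<epsilon> k)"
          using elim(1) by (auto simp: Q_def ext_ln_def)
        then show ?case
          using exponent_bound_pos[OF x0 x assms(3)[OF \<open>\<omega> \<in> space M\<close>] less_imp_le[OF elim(2)]]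
          by blast
      qed
      then show "summable (\<lambda>k. cmod (f k * exp (complex_of_real x * of_real (lam k \<omega>))))"
        using x x0 by (intro summable_dirichlet_series[OF assms(4),
              where c = "(\<rho> - x) / \<bar>\<rho> + x\<bar>"]) auto
    qed
  qed
next
  interpret prob_space M by fact
  note [measurable] = assms(2)
  fix \<rho> :: real and \<epsilon> :: "nat \<Rightarrow> real"
  assume \<rho>: "\<rho> \<le> 0" and \<epsilon>: "\<forall>k. 0 < \<epsilon> k" and lim: "\<epsilon> \<longlonglongrightarrow> 0"
    and sum: "summable (\<lambda>k. dist_fun M (lam k) (ext_ln (cmod (f k)) / ereal (- \<rho> + \<epsilon> k)))"
  have "AE \<omega> in M. \<forall>\<^sub>F k in sequentially.
      \<not> ereal (lam k \<omega>) < ext_ln (cmod (f k)) / ereal (- \<rho> + \<epsilon> k)"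
    using sum by (intro AE_eventually_not_of_summable_prob) (simp_all add: dist_fun_def)
  then show "AE \<omega> in M. ereal \<rho> \<le> abscissa_abs_conv f (\<lambda>k. lam k \<omega>)"
    using AE_space
  proof eventually_elim
    case (elim \<omega>)
    show ?case
    proof (rule le_abscissa_abs_convI)
      show "- \<infinity> < ereal \<rho>" by simp
      fix x assume x: "x < \<rho>"
      have "\<forall>\<^sub>F k in sequentially. \<epsilon> k < (\<rho> - x) / 2"
        using x by (intro order_tendstoD(2)[OF lim]) simp
      with elim(1) have "\<forall>\<^sub>F k in sequentially. f k \<noteq> 0 \<longrightarrow> ln (cmod (f k)) + x * lam k \<omega>
          \<le> - ((\<rho> - x) / \<bar>\<rho> + x\<bar>) * \<bar>ln (cmod (f k))\<bar>"
      proof eventually_elim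
        case (elim k)
        have "0 < \<epsilon> k" using \<epsilon> by simp
        moreover from this have "- \<rho> + \<epsilon> k \<noteq> 0" using \<rho> by argo
        ultimately have "f k \<noteq> 0 \<longrightarrow> ln (cmod (f k)) / (- \<rho> + \<epsilon> k) \<le> lam k \<omega>"
          using elim(1) by (auto simp: ext_ln_def not_less)
        then show ?case
          using exponent_bound_nonpos[OF x \<rho> assms(3)[OF \<open>\<omega> \<in> space M\<close>] \<open>0 < \<epsilon> k\<close>
              less_imp_le[OF elim(2)]]
          by blast
      qed
      then show "summable (\<lambda>k. cmod (f k * exp (complex_of_real x * of_real (lam k \<omega>))))"
        using x \<rho> by (intro summable_dirichlet_series[OF assms(4),
              where c = "(\<rho> - x) / \<bar>\<rho> + x\<bar>"]) auto
    qed
  qed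
qed

end
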